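(* Fix a time $t$, with store levels $s=s(t-1)$ at the start of time $t$ and residual energy $\mathit{re}(t)$. When the objective is the minimisation of total unserved energy over some given period of time, then, under the linearisation described in the context (i.e. for the problem of choosing feasible rates $r(t)=(r_i(t),\,i\in S)$ at time $t$ to maximise $$\sum_{i\in S}v^t_i(s)\,r_i(t)-\max(0,-u(t))\,),$$ the optimal charging, discharging and cross-charging decisions are given by the following procedure. (1) When charging, i.e. if $\mathit{re}(t)\ge0$: charge the stores in order of their charging priority, charging each successive store as far as permitted (the minimum of its input rate and its residual capacity) until the energy available for charging at time $t$ is used as far as possible, any remaining energy being spilled. (2) When discharging, i.e. if $\mathit{re}(t)<0$: discharge the stores in order of their discharging priority, discharging each successive store as far as permitted (the minimum of its output rate and its available stored energy) until the demand at time $t$ is met as fully as possible, any remaining demand being unserved energy. (3) Subsequent to either of (1) or (2): choose pairs of stores $(i,j)$ in succession by, at each successive stage, selecting store $i$ to be the store with the highest discharging priority which is still able to supply energy at time $t$, and store $j$ to be the store with the highest charging priority which is still able to accept energy at time $t$; for each such successive pair $(i,j)$, provided that $$v^t_i(s)<\eta_j v^t_j(s),$$ cross-charge as much energy as possible from store $i$ to store $j$. In (3), the process necessarily terminates on the first occasion on which the condition $v^t_i(s)<\eta_jv^t_j(s)$ fails to be satisfied. Further, no cross-charging can occur when $\mathit{re}(t)\ge0$ and there is spilled energy, or when $\mathit{re}(t)<0$ and there is unserved energy.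
   Context: Time is discrete. $S$ is a finite set of stores. Each store $i\in S$ has capacity $E_i>0$, maximum output rate $P_i>0$, maximum (external) input rate $Q_i>0$ and round-trip efficiency $\eta_i\in(0,1]$ (all losses accounted for at input). The level of store $i$ at the end of time $t$ is $s_i(t)=s_i(t-1)+r_i(t)$, where $r_i(t)$ is the rate at which energy is added to store $i$ at time $t$. The residual energy $\mathit{re}(t)\in\mathbb{R}$ is the surplus of generation over demand at time $t$. The imbalance is $$u(t)=\mathit{re}(t)-\Bigl(\sum_{i:\,r_i(t)<0}r_i(t)+\sum_{i:\,r_i(t)\ge0}r_i(t)/\eta_i\Bigr).$$ Rates $r(t)$ are feasible at time $t$ (given $s=s(t-1)$ with $0\le s_i\le E_i$) if for all $i\in S$: $0\le s_i+r_i(t)\le E_i$; $-P_i\le r_i(t)\le\eta_iQ_i$; and $\mathit{re}(t)\ge0\Rightarrow u(t)\ge0$, $\mathit{re}(t)\le0\Rightarrow u(t)\le0$. When $\mathit{re}(t)\ge0$, $u(t)$ is the spilled energy at time $t$; when $\mathit{re}(t)\le0$, $-u(t)$ is the unserved energy at time $t$. Total unserved energy is the sum over times of $\max(0,-u(t))$. Value function and linearisation: $V^t(s)$ is the dynamic-programming value function, i.e. the future value (negative of expected future unserved energy, relative to a reference state) of having store levels $s=(s_i,\,i\in S)$ at time $t$; $v^t_i(s)$ is its partial derivative with respect to $s_i$. These satisfy $0\le v^t_i(s)\le1$, and $v^t_i(s)$ is decreasing in $s_i$. An optimal decision at time $t$ maximises the value of the resulting state less the energy unserved at time $t$. Under the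 linearisation, changes of store levels over a single time step are assumed small enough that changes in the value function may be measured by the partial derivatives, so that the decision problem at time $t$ is to choose feasible $r(t)$ to maximise $\sum_{i\in S}v^t_i(s)r_i(t)-\max(0,-u(t))$, where $s=s(t-1)$ and the quantities $v^t_i(s)$ are held fixed. Priorities: store $i$ has charging priority over store $j$ if $\eta_iv^t_i(s)>\eta_jv^t_j(s)$; store $i$ has discharging priority over store $j$ if $v^t_i(s)<v^t_j(s)$. Ties in either ordering are broken arbitrarily. Conventions: charging store $j$ "as far as permitted" means up to $r_j(t)=\min(\eta_jQ_j,\,E_j-s_j)$, where adding $r_j(t)\ge 0$ to store $j$ uses $r_j(t)/\eta_j$ of external energy; discharging store $i$ "as far as permitted" means down to $r_i(t)=-\min(P_i,s_i)$. A store is still able to supply (respectively accept) energy if its current rate can be further decreased (respectively increased) subject to its own rate and capacity constraints. Cross-charging from store $i$ to store $j$ means further discharging $i$ by some amount and using that amount to further charge $j$ (so that $j$ gains $\eta_j$ times that amount), leaving $u(t)$ unchanged. *)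

theory Defs
  imports Complex_Main
begin

record 'i storage =
  stores :: "'i set"
  capacity :: "'i \<Rightarrow> real"
  output_rate :: "'i \<Rightarrow> real"
  input_rate :: "'i \<Rightarrow> real"
  efficiency :: "'i \<Rightarrow> real"

definition valid_storage :: "'i storage \<Rightarrow> bool" where
  "valid_storage X \<longleftrightarrow> finite (stores X) \<and>
     (\<forall>i\<in>stores X. capacity X i > 0 \<and> output_rate X i > 0 \<and> input_rate X i > 0
        \<and> 0 < efficiency X i \<and> efficiency X i \<le> 1)"

definition levels :: "'i storage \<Rightarrow> ('i \<Rightarrow> real) set" where
  "levels X = {s. \<forall>i\<in>stores X. 0 \<le> s i \<and> s i \<le> capacity X i}"

text \<open>
  The partial derivatives of a value function, with the properties they are taken to have.
  At the two ends of the range of a store level the derivative is one-sided. Nothing else about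
  how the value function arises (horizon, law of the future residual energies) is used.
\<close>

definition marginal_values ::
  "'i storage \<Rightarrow> (('i \<Rightarrow> real) \<Rightarrow> real) \<Rightarrow> ('i \<Rightarrow> ('i \<Rightarrow> real) \<Rightarrow> real) \<Rightarrow> bool" where
  "marginal_values X V v \<longleftrightarrow> (\<forall>s\<in>levels X. \<forall>i\<in>stores X.
     ((\<lambda>x. V (s(i := x))) has_real_derivative v i s) (at (s i) within {0..capacity X i}) \<and>
     0 \<le> v i s \<and> v i s \<le> 1 \<and>
     (\<forall>x\<in>{s i..capacity X i}. v i (s(i := x)) \<le> v i s))"

text \<open>
  In what follows \<open>s\<close> are the levels at the start of the time step, \<open>re\<close> is the residual
  energy and \<open>r\<close> are the rates; values of \<open>s\<close> and \<open>r\<close> outside \<open>stores X\<close> are irrelevant.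
\<close>

definition imbalance :: "'i storage \<Rightarrow> real \<Rightarrow> ('i \<Rightarrow> real) \<Rightarrow> real" where
  "imbalance X re r =
     re - ((\<Sum>i\<in>{i\<in>stores X. r i < 0}. r i)
           + (\<Sum>i\<in>{i\<in>stores X. r i \<ge> 0}. r i / efficiency X i))"

definition rate_permitted :: "'i storage \<Rightarrow> ('i \<Rightarrow> real) \<Rightarrow> 'i \<Rightarrow> real \<Rightarrow> bool" where
  "rate_permitted X s i x \<longleftrightarrow> 0 \<le> s i + x \<and> s i + x \<le> capacity X i \<and>
     - output_rate X i \<le> x \<and> x \<le> efficiency X i * input_rate X i"

definition feasible :: "'i storage \<Rightarrow> ('i \<Rightarrow> real) \<Rightarrow> real \<Rightarrow> ('i \<Rightarrow> real) \<Rightarrow> bool" where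
  "feasible X s re r \<longleftrightarrow> (\<forall>i\<in>stores X. rate_permitted X s i (r i)) \<and>
     (re \<ge> 0 \<longrightarrow> imbalance X re r \<ge> 0) \<and> (re \<le> 0 \<longrightarrow> imbalance X re r \<le> 0)"

definition linearised_value ::
  "'i storage \<Rightarrow> ('i \<Rightarrow> ('i \<Rightarrow> real) \<Rightarrow> real) \<Rightarrow> ('i \<Rightarrow> real) \<Rightarrow> real \<Rightarrow> ('i \<Rightarrow> real) \<Rightarrow> real" where
  "linearised_value X v s re r =
     (\<Sum>i\<in>stores X. v i s * r i) - max 0 (- imbalance X re r)"

definition charging_priority ::
  "'i storage \<Rightarrow> ('i \<Rightarrow> ('i \<Rightarrow> real) \<Rightarrow> real) \<Rightarrow> ('i \<Rightarrow> real) \<Rightarrow> 'i \<Rightarrow> 'i \<Rightarrow> bool" where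
  "charging_priority X v s i j \<longleftrightarrow> efficiency X i * v i s > efficiency X j * v j s"

definition discharging_priority ::
  "('i \<Rightarrow> ('i \<Rightarrow> real) \<Rightarrow> real) \<Rightarrow> ('i \<Rightarrow> real) \<Rightarrow> 'i \<Rightarrow> 'i \<Rightarrow> bool" where
  "discharging_priority v s i j \<longleftrightarrow> v i s < v j s"

text \<open>
  Enumerations of the stores in which no store precedes one having priority over it; every way
  of breaking ties is allowed.
\<close>

definition charging_order ::
  "'i storage \<Rightarrow> ('i \<Rightarrow> ('i \<Rightarrow> real) \<Rightarrow> real) \<Rightarrow> ('i \<Rightarrow> real) \<Rightarrow> 'i list \<Rightarrow> bool" where
  "charging_order X v s xs \<longleftrightarrow> distinct xs \<and> set xs = stores X \<and>
     sorted_wrt (\<lambda>i j. \<not> charging_priority X v s j i) xs"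

definition discharging_order ::
  "'i storage \<Rightarrow> ('i \<Rightarrow> ('i \<Rightarrow> real) \<Rightarrow> real) \<Rightarrow> ('i \<Rightarrow> real) \<Rightarrow> 'i list \<Rightarrow> bool" where
  "discharging_order X v s xs \<longleftrightarrow> distinct xs \<and> set xs = stores X \<and>
     sorted_wrt (\<lambda>i j. \<not> discharging_priority v s j i) xs"

text \<open>
  The last argument is the energy still available for charging (the demand still to be met);
  it is external energy, so a store of efficiency \<open>\<eta>\<close> gains only \<open>\<eta>\<close> times what it uses.
\<close>

fun charge_in_order :: "'i storage \<Rightarrow> ('i \<Rightarrow> real) \<Rightarrow> 'i list \<Rightarrow> real \<Rightarrow> 'i \<Rightarrow> real" where
  "charge_in_order X s [] e = (\<lambda>_. 0)"
| "charge_in_order X s (i # is) e =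
     (let x = min (min (efficiency X i * input_rate X i) (capacity X i - s i)) (efficiency X i * e)
      in (charge_in_order X s is (e - x / efficiency X i))(i := x))"

fun discharge_in_order :: "'i storage \<Rightarrow> ('i \<Rightarrow> real) \<Rightarrow> 'i list \<Rightarrow> real \<Rightarrow> 'i \<Rightarrow> real" where
  "discharge_in_order X s [] d = (\<lambda>_. 0)"
| "discharge_in_order X s (i # is) d =
     (let x = min (min (output_rate X i) (s i)) d
      in (discharge_in_order X s is (d - x))(i := - x))"

definition initial_rates ::
  "'i storage \<Rightarrow> ('i \<Rightarrow> ('i \<Rightarrow> real) \<Rightarrow> real) \<Rightarrow> ('i \<Rightarrow> real) \<Rightarrow> real \<Rightarrow> ('i \<Rightarrow> real) \<Rightarrow> bool" where
  "initial_rates X v s re r \<longleftrightarrow>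
     (if re \<ge> 0 then \<exists>xs. charging_order X v s xs \<and> r = charge_in_order X s xs re
      else \<exists>xs. discharging_order X v s xs \<and> r = discharge_in_order X s xs (- re))"

definition can_supply :: "'i storage \<Rightarrow> ('i \<Rightarrow> real) \<Rightarrow> ('i \<Rightarrow> real) \<Rightarrow> 'i \<Rightarrow> bool" where
  "can_supply X s r i \<longleftrightarrow> i \<in> stores X \<and> (\<exists>x<r i. rate_permitted X s i x)"

definition can_accept :: "'i storage \<Rightarrow> ('i \<Rightarrow> real) \<Rightarrow> ('i \<Rightarrow> real) \<Rightarrow> 'i \<Rightarrow> bool" where
  "can_accept X s r j \<longleftrightarrow> j \<in> stores X \<and> (\<exists>x>r j. rate_permitted X s j x)"

definition selected_pair ::
  "'i storage \<Rightarrow> ('i \<Rightarrow> ('i \<Rightarrow> real) \<Rightarrow> real) \<Rightarrow> ('i \<Rightarrow> real) \<Rightarrow> ('i \<Rightarrow> real) \<Rightarrow> 'i \<Rightarrow> 'i \<Rightarrow> bool" where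
  "selected_pair X v s r i j \<longleftrightarrow>
     can_supply X s r i \<and> (\<forall>k. can_supply X s r k \<longrightarrow> \<not> discharging_priority v s k i) \<and>
     can_accept X s r j \<and> (\<forall>k. can_accept X s r k \<longrightarrow> \<not> charging_priority X v s k j)"

definition worthwhile ::
  "'i storage \<Rightarrow> ('i \<Rightarrow> ('i \<Rightarrow> real) \<Rightarrow> real) \<Rightarrow> ('i \<Rightarrow> real) \<Rightarrow> 'i \<Rightarrow> 'i \<Rightarrow> bool" where
  "worthwhile X v s i j \<longleftrightarrow> v i s < efficiency X j * v j s"

definition transfer :: "'i storage \<Rightarrow> 'i \<Rightarrow> 'i \<Rightarrow> real \<Rightarrow> ('i \<Rightarrow> real) \<Rightarrow> 'i \<Rightarrow> real" where
  "transfer X i j a r = r(i := r i - a, j := r j + efficiency X j * a)"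

definition transfer_permitted ::
  "'i storage \<Rightarrow> ('i \<Rightarrow> real) \<Rightarrow> 'i \<Rightarrow> 'i \<Rightarrow> ('i \<Rightarrow> real) \<Rightarrow> real \<Rightarrow> bool" where
  "transfer_permitted X s i j r a \<longleftrightarrow> a \<ge> 0 \<and>
     rate_permitted X s i (transfer X i j a r i) \<and> rate_permitted X s j (transfer X i j a r j)"

text \<open>
  Cross-charging the largest permitted amount. That the imbalance is left unchanged is not
  imposed here: it holds provided that the supplying store is not charging and the accepting
  store is not discharging.
\<close>

definition cross_charge ::
  "'i storage \<Rightarrow> ('i \<Rightarrow> real) \<Rightarrow> 'i \<Rightarrow> 'i \<Rightarrow> ('i \<Rightarrow> real) \<Rightarrow> ('i \<Rightarrow> real) \<Rightarrow> bool" where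
  "cross_charge X s i j r r' \<longleftrightarrow>
     (\<exists>a. transfer_permitted X s i j r a \<and> (\<forall>b. transfer_permitted X s i j r b \<longrightarrow> b \<le> a) \<and>
          r' = transfer X i j a r)"

definition cross_charging_stage ::
  "'i storage \<Rightarrow> ('i \<Rightarrow> ('i \<Rightarrow> real) \<Rightarrow> real) \<Rightarrow> ('i \<Rightarrow> real) \<Rightarrow> ('i \<Rightarrow> real) \<Rightarrow> ('i \<Rightarrow> real) \<Rightarrow> bool" where
  "cross_charging_stage X v s r r' \<longleftrightarrow>
     (\<exists>i j. selected_pair X v s r i j \<and> worthwhile X v s i j \<and> cross_charge X s i j r r')"

text \<open>
  Cross-charging is over when the selected pair fails the condition, or when there is no pair
  left to select.
\<close>

definition procedure_result ::
  "'i storage \<Rightarrow> ('i \<Rightarrow> ('i \<Rightarrow> real) \<Rightarrow> real) \<Rightarrow> ('i \<Rightarrow> real) \<Rightarrow> real \<Rightarrow> ('i \<Rightarrow> real) \<Rightarrow> bool" where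
  "procedure_result X v s re r \<longleftrightarrow>
     (\<exists>r0. initial_rates X v s re r0 \<and> (cross_charging_stage X v s)\<^sup>*\<^sup>* r0 r) \<and>
     (\<forall>i j. selected_pair X v s r i j \<longrightarrow> \<not> worthwhile X v s i j)"

end

theory Submission
  imports Defs
begin

text \<open>
  Why greed is optimal. Measure the rate of each store by the external energy it uses, which is
  \<open>r / \<eta>\<close> when charging at rate \<open>r\<close> and \<open>r\<close> itself when discharging. The imbalance is then affine
  in the new variables, and the worth of a store is concave in its variable, since the slope is
  \<open>w\<close> below \<open>0\<close> and \<open>\<eta> w \<le> w\<close> above it, where \<open>w\<close> is the marginal value of the store. So the
  problem is a separable concave one with a single coupling constraint, and rates are optimal as
  soon as there is a price \<open>\<mu> \<in> [0, 1]\<close> of external energy such that no store gains by moving at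
  that price, with \<open>\<mu> = 0\<close> if energy is spilled and \<open>\<mu> = 1\<close> if demand is unserved
  (\<open>finished_optimal\<close>).

  Such a price exists if the slope of every store that can move up is at most the slope of every
  store that can move down. For a store that accepts and a store that supplies, the comparison is
  of one of four kinds, according to whether the first is discharging and whether the second is
  charging. Three of them are invariants of the procedure (\<open>respects_priorities\<close>): the greedy
  filling establishes them, and cross-charging between the best supplier and the best acceptor
  keeps them. The fourth, between a store that is not discharging and one that is not charging,
  says that no cross-charging pair is worthwhile, which is exactly the condition for stopping.
  Hence \<open>multiplier_exists\<close>.

  The same invariants show that a worthwhile pair never has a charging supplier or a
  discharging acceptor (\<open>worthwhile_pair_signs\<close>). So a stage leaves the imbalance unchanged, and
  no store ever reverses direction. Each stage drives one of its two stores to a bound, where it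
  remains, and the procedure ends (\<open>cross_charging_stage_decreases\<close>). If energy is spilled after
  the greedy filling then no store can accept any, and if demand is unserved then none can supply
  any, so in these cases there is no pair to select.
\<close>

section \<open>Greedy filling in a given order\<close>

text \<open>
  In terms of external energy, charging and discharging in order are the same process: a budget
  \<open>e\<close> is spent on the list, up to the cap \<open>c i\<close> at each entry.
\<close>

fun greedy_fill :: "('i \<Rightarrow> real) \<Rightarrow> 'i list \<Rightarrow> real \<Rightarrow> 'i \<Rightarrow> real" where
  "greedy_fill c [] e = (\<lambda>_. 0)"
| "greedy_fill c (i # is) e =
     (let y = min (c i) e in (greedy_fill c is (e - y))(i := y))"

lemma greedy_fill_zero:
  assumes "\<forall>i\<in>set xs. 0 \<le> c i"
  shows "greedy_fill c xs 0 = (\<lambda>_. 0)"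
  using assms by (induction xs) (auto simp: Let_def min_absorb2)

lemma greedy_fill_bounds:
  assumes "\<forall>i\<in>set xs. 0 \<le> c i" "0 \<le> e" "i \<in> set xs"
  shows "0 \<le> greedy_fill c xs e i \<and> greedy_fill c xs e i \<le> c i"
  using assms by (induction xs arbitrary: e) (auto simp: Let_def min_def)

lemma sum_greedy_fill:
  assumes "\<forall>i\<in>set xs. 0 \<le> c i" "0 \<le> e" "distinct xs"
  shows "(\<Sum>i\<in>set xs. greedy_fill c xs e i) \<le> e"
    and "(\<Sum>i\<in>set xs. greedy_fill c xs e i) < e \<Longrightarrow> i \<in> set xs \<Longrightarrow> greedy_fill c xs e i = c i"
proof -
  have "(\<Sum>i\<in>set xs. greedy_fill c xs e i) \<le> e \<and>
      ((\<Sum>i\<in>set xs. greedy_fill c xs e i) < e \<longrightarrow> (\<forall>i\<in>set xs. greedy_fill c xs e i = c i))"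
    using assms
  proof (induction xs arbitrary: e)
    case (Cons a xs)
    define e' where "e' = e - min (c a) e"
    have IH: "(\<Sum>i\<in>set xs. greedy_fill c xs e' i) \<le> e' \<and>
      ((\<Sum>i\<in>set xs. greedy_fill c xs e' i) < e' \<longrightarrow> (\<forall>i\<in>set xs. greedy_fill c xs e' i = c i))"
      using Cons.prems by (intro Cons.IH) (auto simp: e'_def)
    have fill: "greedy_fill c (a # xs) e = (greedy_fill c xs e')(a := min (c a) e)"
      by (simp add: Let_def e'_def)
    have total: "(\<Sum>i\<in>set (a # xs). greedy_fill c (a # xs) e i)
        = min (c a) e + (\<Sum>i\<in>set xs. greedy_fill c xs e' i)"
      using Cons.prems(3) unfolding fill
      by (simp cong: sum.cong) (intro sum.cong, auto)
    have head: "min (c a) e = c a" if "(\<Sum>i\<in>set xs. greedy_fill c xs e' i) < e'"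
    proof (rule ccontr)
      assume "min (c a) e \<noteq> c a"
      then have "e' = 0"
        by (auto simp: e'_def min_def split: if_splits)
      then show False
        using that greedy_fill_zero[of xs c] Cons.prems(1) by simp
    qed
    have "greedy_fill c (a # xs) e i = c i"
      if "(\<Sum>i\<in>set xs. greedy_fill c xs e' i) < e'" "i \<in> set (a # xs)" for i
      using IH head[OF that(1)] that unfolding fill by auto
    moreover have "e = min (c a) e + e'"
      by (simp add: e'_def)
    ultimately show ?case
      using IH unfolding total by (metis add_le_cancel_left add_less_cancel_left)
  qed simp
  then show "(\<Sum>i\<in>set xs. greedy_fill c xs e i) \<le> e"
    and "(\<Sum>i\<in>set xs. greedy_fill c xs e i) < e \<Longrightarrow> i \<in> set xs \<Longrightarrow> greedy_fill c xs e i = c i"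
    by auto
qed

text \<open>
  An entry below its cap has exhausted the budget, so nothing is left for the entries after it.
\<close>

lemma greedy_fill_in_order:
  assumes "\<forall>i\<in>set xs. 0 \<le> c i" "0 \<le> e" "sorted_wrt R xs"
    and "i \<in> set xs" "0 < greedy_fill c xs e i"
    and "j \<in> set xs" "greedy_fill c xs e j < c j"
  shows "i = j \<or> R i j"
  using assms
proof (induction xs arbitrary: e)
  case (Cons a xs)
  define e' where "e' = e - min (c a) e"
  have fill: "greedy_fill c (a # xs) e = (greedy_fill c xs e')(a := min (c a) e)"
    by (simp add: Let_def e'_def)
  have e': "0 \<le> e'"
    by (simp add: e'_def)
  show ?case
  proof (cases "i = a")
    case True
    then show ?thesis
      using Cons.prems(3,6) by auto
  next
    case False
    then have i: "i \<in> set xs" "0 < greedy_fill c xs e' i"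
      using Cons.prems(4,5) unfolding fill by auto
    have "j \<noteq> a"
    proof
      assume "j = a"
      then have "e' = 0"
        using Cons.prems(7) unfolding fill by (auto simp: e'_def min_def split: if_splits)
      then show False
        using i greedy_fill_zero[of xs c] Cons.prems(1) by simp
    qed
    then show ?thesis
      using Cons.IH[OF _ e' _ i] Cons.prems unfolding fill by auto
  qed
qed simp

section \<open>A single time step\<close>

locale storage_step =
  fixes X :: "'i storage"
    and v :: "'i \<Rightarrow> ('i \<Rightarrow> real) \<Rightarrow> real"
    and s :: "'i \<Rightarrow> real"
  assumes valid: "valid_storage X"
    and levels: "s \<in> levels X"
    and value_bounds: "i \<in> stores X \<Longrightarrow> 0 \<le> v i s \<and> v i s \<le> 1"
begin

abbreviation \<eta> :: "'i \<Rightarrow> real" where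
  "\<eta> \<equiv> efficiency X"

abbreviation w :: "'i \<Rightarrow> real" where
  "w i \<equiv> v i s"

definition lo :: "'i \<Rightarrow> real" where
  "lo i = - min (output_rate X i) (s i)"

definition hi :: "'i \<Rightarrow> real" where
  "hi i = min (\<eta> i * input_rate X i) (capacity X i - s i)"

definition external :: "'i \<Rightarrow> real \<Rightarrow> real" where
  "external i x = (if x < 0 then x else x / \<eta> i)"

lemma finite_stores [simp]: "finite (stores X)"
  using valid by (simp add: valid_storage_def)

lemma efficiency_bounds:
  assumes "i \<in> stores X"
  shows "0 < \<eta> i" "\<eta> i \<le> 1"
  using assms valid by (auto simp: valid_storage_def)

lemma charging_value_le:
  assumes "i \<in> stores X"
  shows "0 \<le> \<eta> i * w i" "\<eta> i * w i \<le> w i"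
  using efficiency_bounds[OF assms] value_bounds[OF assms]
  by (auto simp: mult_left_le_one_le)

lemma lo_le_0:
  assumes "i \<in> stores X"
  shows "lo i \<le> 0"
  using assms valid levels by (force simp: lo_def valid_storage_def levels_def)

lemma hi_ge_0:
  assumes "i \<in> stores X"
  shows "0 \<le> hi i"
  using assms valid levels by (auto simp: hi_def valid_storage_def levels_def less_imp_le)

lemma rate_permitted_iff: "rate_permitted X s i x \<longleftrightarrow> lo i \<le> x \<and> x \<le> hi i"
  by (auto simp: rate_permitted_def lo_def hi_def min_def)

lemma imbalance_eq: "imbalance X re r = re - (\<Sum>i\<in>stores X. external i (r i))"
proof -
  have "(\<Sum>i\<in>stores X. external i (r i)) =
      (\<Sum>i\<in>{i\<in>stores X. r i < 0}. external i (r i)) + (\<Sum>i\<in>{i\<in>stores X. r i \<ge> 0}. external i (r i))"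
    by (subst sum.union_disjoint [symmetric]) (auto intro!: sum.cong)
  then show ?thesis
    by (simp add: imbalance_def external_def)
qed

text \<open>
  A price \<open>\<mu>\<close> that separates the slopes on the two sides of \<open>x\<close> makes \<open>x\<close> optimal for the single
  store: as a function of external energy, \<open>w i * x\<close> is concave, and \<open>\<mu>\<close> is a supergradient.
\<close>

lemma external_optimal:
  assumes i: "i \<in> stores X" and lam: "0 \<le> \<mu>"
    and y: "lo i \<le> y" "y \<le> hi i"
    and up: "x < hi i \<Longrightarrow> (if 0 \<le> x then \<eta> i * w i else w i) \<le> \<mu>"
    and down: "lo i < x \<Longrightarrow> \<mu> \<le> (if 0 < x then \<eta> i * w i else w i)"
  shows "w i * y - \<mu> * external i y \<le> w i * x - \<mu> * external i x"
proof -
  note eta = efficiency_bounds[OF i]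
  have expand: "z \<le> z / \<eta> i" if "0 \<le> z" for z
    using that eta by (simp add: field_simps mult_right_le_one_le)
  consider "y = x" | "x < y" "0 \<le> x" | "x < y" "x < 0" | "y < x" "0 < x" | "y < x" "x \<le> 0"
    by linarith
  then show ?thesis
  proof cases
    case 2
    then have "w i \<le> \<mu> / \<eta> i"
      using up y eta by (simp add: field_simps)
    then have "w i * (y - x) \<le> \<mu> / \<eta> i * (y - x)"
      using 2 by (intro mult_right_mono) auto
    then show ?thesis
      using 2 by (simp add: external_def right_diff_distrib diff_divide_distrib)
  next
    case 3
    then have "w i * (y - x) \<le> \<mu> * (y - x)"
      using up y by (intro mult_right_mono) auto
    moreover have "\<mu> * (y - x) \<le> \<mu> * (external i y - external i x)"
      using 3 expand[of y] lam by (intro mult_left_mono) (auto simp: external_def)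
    ultimately show ?thesis
      by (simp add: right_diff_distrib)
  next
    case 4
    then have "\<mu> / \<eta> i \<le> w i"
      using down y eta by (simp add: field_simps)
    then have "\<mu> / \<eta> i * (x - y) \<le> w i * (x - y)"
      using 4 by (intro mult_right_mono) auto
    moreover have "\<mu> * (external i x - external i y) \<le> \<mu> * ((x - y) / \<eta> i)"
      using 4 expand[of "- y"] lam
      by (intro mult_left_mono) (auto simp: external_def diff_divide_distrib)
    ultimately have "\<mu> * (external i x - external i y) \<le> w i * (x - y)"
      by simp
    then show ?thesis
      by (simp add: right_diff_distrib)
  next
    case 5
    then have "\<mu> * (x - y) \<le> w i * (x - y)"
      using down y by (intro mult_right_mono) auto
    then show ?thesis
      using 5 by (auto simp: external_def right_diff_distrib)
  qed simp
qed

section \<open>The invariant of the procedure\<close>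

definition permitted :: "('i \<Rightarrow> real) \<Rightarrow> bool" where
  "permitted r \<longleftrightarrow> (\<forall>i\<in>stores X. lo i \<le> r i \<and> r i \<le> hi i)"

lemma can_supply_iff:
  assumes "permitted r"
  shows "can_supply X s r i \<longleftrightarrow> i \<in> stores X \<and> lo i < r i"
  using assms by (force simp: can_supply_def rate_permitted_iff permitted_def)

lemma can_accept_iff:
  assumes "permitted r"
  shows "can_accept X s r i \<longleftrightarrow> i \<in> stores X \<and> r i < hi i"
  using assms by (force simp: can_accept_def rate_permitted_iff permitted_def)

text \<open>
  No store is used while a better one remains available for the same purpose, and no stored energy
  has been moved at a loss. Each clause compares the slope of a store that can move up with that
  of one that can move down.
\<close>

definition respects_priorities :: "('i \<Rightarrow> real) \<Rightarrow> bool" where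
  "respects_priorities r \<longleftrightarrow> (\<forall>i\<in>stores X. \<forall>j\<in>stores X.
     (0 < r i \<and> r j < hi j \<longrightarrow> \<eta> j * w j \<le> \<eta> i * w i) \<and>
     (r i < 0 \<and> lo j < r j \<longrightarrow> w i \<le> w j) \<and>
     (r i < 0 \<and> 0 < r j \<longrightarrow> w i \<le> \<eta> j * w j))"

definition balanced_as_far_as_possible :: "real \<Rightarrow> ('i \<Rightarrow> real) \<Rightarrow> bool" where
  "balanced_as_far_as_possible re r \<longleftrightarrow>
     (re \<ge> 0 \<longrightarrow> imbalance X re r \<ge> 0) \<and> (re \<le> 0 \<longrightarrow> imbalance X re r \<le> 0) \<and>
     (re \<ge> 0 \<and> imbalance X re r > 0 \<longrightarrow> (\<forall>i. \<not> can_accept X s r i)) \<and>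
     (re < 0 \<and> imbalance X re r < 0 \<longrightarrow> (\<forall>i. \<not> can_supply X s r i))"

definition procedure_invariant :: "real \<Rightarrow> ('i \<Rightarrow> real) \<Rightarrow> bool" where
  "procedure_invariant re r \<longleftrightarrow>
     permitted r \<and> respects_priorities r \<and> balanced_as_far_as_possible re r"

section \<open>The greedy filling establishes the invariant\<close>

lemma charge_in_order_eq:
  assumes "set xs \<subseteq> stores X"
  shows "charge_in_order X s xs e = (\<lambda>i. \<eta> i * greedy_fill (\<lambda>i. hi i / \<eta> i) xs e i)"
  using assms
proof (induction xs arbitrary: e)
  case (Cons a xs)
  then have a: "0 < \<eta> a"
    using efficiency_bounds by auto
  have "min (hi a) (\<eta> a * e) = \<eta> a * min (hi a / \<eta> a) e"
    using a by (auto simp: min_def field_simps)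
  then show ?case
    using Cons a by (auto simp: Let_def hi_def fun_eq_iff)
qed auto

lemma discharge_in_order_eq:
  "discharge_in_order X s xs d = (\<lambda>i. - greedy_fill (\<lambda>i. - lo i) xs d i)"
  by (induction xs arbitrary: d) (auto simp: Let_def lo_def fun_eq_iff)

lemma initial_rates_invariant:
  assumes "initial_rates X v s re r"
  shows "procedure_invariant re r"
proof (cases "re \<ge> 0")
  case True
  then obtain xs where xs: "charging_order X v s xs" and r: "r = charge_in_order X s xs re"
    using assms by (auto simp: initial_rates_def)
  define f where "f = greedy_fill (\<lambda>i. hi i / \<eta> i) xs re"
  have set_xs: "set xs = stores X" and "distinct xs"
    and sorted: "sorted_wrt (\<lambda>i j. \<not> charging_priority X v s j i) xs"
    using xs by (auto simp: charging_order_def)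
  have nonneg: "\<forall>i\<in>set xs. 0 \<le> hi i / \<eta> i"
    using hi_ge_0 efficiency_bounds(1) set_xs by (simp add: less_imp_le)
  have r_eq: "r i = \<eta> i * f i" for i
    using charge_in_order_eq[of xs re] set_xs r f_def by simp
  have f: "0 \<le> f i \<and> f i \<le> hi i / \<eta> i" if "i \<in> stores X" for i
    using greedy_fill_bounds[OF nonneg True, of i] that set_xs f_def by simp
  have r_bounds: "0 \<le> r i \<and> r i \<le> hi i" if "i \<in> stores X" for i
    using f[OF that] efficiency_bounds[OF that] by (simp add: r_eq field_simps)
  have "external i (r i) = f i" if "i \<in> stores X" for i
    using r_bounds[OF that] efficiency_bounds[OF that] by (simp add: external_def r_eq)
  then have imb: "imbalance X re r = re - (\<Sum>i\<in>set xs. f i)"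
    by (simp add: imbalance_eq set_xs)
  have permitted: "permitted r"
    using r_bounds lo_le_0 by (force simp: permitted_def)
  have "\<eta> j * w j \<le> \<eta> i * w i"
    if "i \<in> stores X" "j \<in> stores X" "0 < r i" "r j < hi j" for i j
  proof -
    have "0 < f i" "f j < hi j / \<eta> j"
      using that efficiency_bounds(1)[of i] efficiency_bounds(1)[of j]
      by (auto simp: r_eq field_simps zero_less_mult_iff)
    then have "i = j \<or> \<not> charging_priority X v s j i"
      using that(1,2) greedy_fill_in_order[OF nonneg True sorted]
      unfolding set_xs f_def by blast
    then show ?thesis
      by (auto simp: charging_priority_def)
  qed
  moreover have "\<not> r i < 0" if "i \<in> stores X" for i
    using r_bounds[OF that] by simp
  ultimately have "respects_priorities r"
    unfolding respects_priorities_def by blast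
  moreover have "balanced_as_far_as_possible re r"
  proof -
    have "imbalance X re r \<ge> 0"
      using sum_greedy_fill(1)[OF nonneg True \<open>distinct xs\<close>] by (simp add: imb f_def)
    moreover have "f i = hi i / \<eta> i" if "imbalance X re r > 0" "i \<in> stores X" for i
      using sum_greedy_fill(2)[OF nonneg True \<open>distinct xs\<close>, of i] that
      unfolding imb set_xs f_def[symmetric] by linarith
    then have "\<not> can_accept X s r i" if "imbalance X re r > 0" for i
      using that efficiency_bounds(1)[of i] by (auto simp: can_accept_iff[OF permitted] r_eq)
    moreover have "imbalance X re r \<le> re"
      using f by (simp add: imb set_xs sum_nonneg)
    ultimately show ?thesis
      using True by (simp add: balanced_as_far_as_possible_def)
  qed
  ultimately show ?thesis
    using permitted by (simp add: procedure_invariant_def)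
next
  case False
  then obtain xs where xs: "discharging_order X v s xs" and r: "r = discharge_in_order X s xs (- re)"
    using assms by (auto simp: initial_rates_def)
  define f where "f = greedy_fill (\<lambda>i. - lo i) xs (- re)"
  have set_xs: "set xs = stores X" and "distinct xs"
    and sorted: "sorted_wrt (\<lambda>i j. \<not> discharging_priority v s j i) xs"
    using xs by (auto simp: discharging_order_def)
  have nonneg: "\<forall>i\<in>set xs. 0 \<le> - lo i"
    using lo_le_0 set_xs by simp
  have demand: "0 \<le> - re"
    using False by simp
  have r_eq: "r i = - f i" for i
    using discharge_in_order_eq[of xs "- re"] r f_def by simp
  have r_bounds: "lo i \<le> r i \<and> r i \<le> 0" if "i \<in> stores X" for i
    using greedy_fill_bounds[OF nonneg demand, of i] that set_xs by (simp add: r_eq f_def)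
  have "external i (r i) = - f i" if "i \<in> stores X" for i
    using r_bounds[OF that] by (auto simp: external_def r_eq)
  then have imb: "imbalance X re r = (\<Sum>i\<in>set xs. f i) - (- re)"
    by (simp add: imbalance_eq set_xs sum_negf)
  have permitted: "permitted r"
    using r_bounds hi_ge_0 by (force simp: permitted_def)
  have "w i \<le> w j"
    if "i \<in> stores X" "j \<in> stores X" "r i < 0" "lo j < r j" for i j
  proof -
    have "0 < f i" "f j < - lo j"
      using that by (auto simp: r_eq)
    then have "i = j \<or> \<not> discharging_priority v s j i"
      using that(1,2) greedy_fill_in_order[OF nonneg demand sorted]
      unfolding set_xs f_def by blast
    then show ?thesis
      by (auto simp: discharging_priority_def)
  qed
  moreover have "\<not> 0 < r i" if "i \<in> stores X" for i
    using r_bounds[OF that] by simp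
  ultimately have "respects_priorities r"
    unfolding respects_priorities_def by blast
  moreover have "balanced_as_far_as_possible re r"
  proof -
    have "imbalance X re r \<le> 0"
      using sum_greedy_fill(1)[OF nonneg demand \<open>distinct xs\<close>] by (simp add: imb f_def)
    moreover have "f i = - lo i" if "imbalance X re r < 0" "i \<in> stores X" for i
      using sum_greedy_fill(2)[OF nonneg demand \<open>distinct xs\<close>, of i] that
      unfolding imb set_xs f_def[symmetric] by linarith
    then have "\<not> can_supply X s r i" if "imbalance X re r < 0" for i
      using that by (simp add: can_supply_iff[OF permitted] r_eq)
    ultimately show ?thesis
      using False by (simp add: balanced_as_far_as_possible_def)
  qed
  ultimately show ?thesis
    using permitted by (simp add: procedure_invariant_def)
qed

section \<open>Cross-charging preserves the invariant\<close>

text \<open>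
  Charging went to stores of charging value at least that of any remaining acceptor \<open>j\<close>, so a
  charging supplier \<open>i\<close> would have \<open>\<eta> j * w j \<le> \<eta> i * w i \<le> w i\<close>. Likewise a discharging acceptor
  \<open>j\<close> would have \<open>\<eta> j * w j \<le> w j \<le> w i\<close>. Both contradict \<open>w i < \<eta> j * w j\<close>.
\<close>

lemma worthwhile_pair_signs:
  assumes "permitted r" "respects_priorities r"
    and "can_supply X s r i" "can_accept X s r j" "worthwhile X v s i j"
  shows "i \<noteq> j" "r i \<le> 0" "0 \<le> r j"
proof -
  have i: "i \<in> stores X" "lo i < r i" and j: "j \<in> stores X" "r j < hi j"
    using assms by (auto simp: can_supply_iff can_accept_iff)
  have lt: "w i < \<eta> j * w j"
    using assms(5) by (simp add: worthwhile_def)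
  show "i \<noteq> j"
    using lt charging_value_le(2)[OF j(1)] by auto
  show "r i \<le> 0"
    using lt assms(2) i j charging_value_le(2)[OF i(1)]
    unfolding respects_priorities_def by (smt (verit))
  show "0 \<le> r j"
    using lt assms(2) i j charging_value_le(2)[OF j(1)]
    unfolding respects_priorities_def by (smt (verit))
qed

lemma imbalance_transfer:
  assumes "i \<in> stores X" "j \<in> stores X" "i \<noteq> j" "r i \<le> 0" "0 \<le> r j" "0 \<le> a"
  shows "imbalance X re (transfer X i j a r) = imbalance X re r"
proof -
  have eta: "0 < \<eta> j"
    using efficiency_bounds(1)[OF assms(2)] .
  then have charging: "\<not> r j + \<eta> j * a < 0"
    using assms(5,6) by (simp add: not_less)
  have "external k (transfer X i j a r k) =
      external k (r k) + ((if k = j then a else 0) - (if k = i then a else 0))"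
    if "k \<in> stores X" for k
    using assms(3-6) eta charging by (auto simp: external_def transfer_def add_divide_distrib)
  then show ?thesis
    using assms(1,2)
    by (simp add: imbalance_eq sum.distrib sum_subtractf)
qed

lemma transfer_permitted_iff:
  assumes "permitted r" "i \<in> stores X" "j \<in> stores X" "i \<noteq> j"
  shows "transfer_permitted X s i j r a \<longleftrightarrow> 0 \<le> a \<and> a \<le> min (r i - lo i) ((hi j - r j) / \<eta> j)"
proof -
  have bounds: "lo i \<le> r i" "r i \<le> hi i" "lo j \<le> r j" "r j \<le> hi j" "0 < \<eta> j"
    using assms efficiency_bounds by (auto simp: permitted_def)
  moreover have "a \<le> (hi j - r j) / \<eta> j \<longleftrightarrow> r j + \<eta> j * a \<le> hi j"
    using \<open>0 < \<eta> j\<close> by (simp add: field_simps)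
  moreover have "lo j \<le> r j + \<eta> j * a" if "0 \<le> a"
    using that bounds by (simp add: add_increasing2)
  ultimately show ?thesis
    using assms(4) by (auto simp: transfer_permitted_def rate_permitted_iff transfer_def)
qed

lemma cross_charge_iff:
  assumes "permitted r" "i \<in> stores X" "j \<in> stores X" "i \<noteq> j"
  shows "cross_charge X s i j r r' \<longleftrightarrow>
    r' = transfer X i j (min (r i - lo i) ((hi j - r j) / \<eta> j)) r"
proof -
  have "0 \<le> min (r i - lo i) ((hi j - r j) / \<eta> j)"
    using assms efficiency_bounds(1)[of j] by (auto simp: permitted_def)
  then show ?thesis
    unfolding cross_charge_def transfer_permitted_iff[OF assms]
    by (metis order.antisym order.refl)
qed

lemma cross_charging_stageE:
  assumes "permitted r" "respects_priorities r" "cross_charging_stage X v s r r'"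
  obtains i j a where "i \<in> stores X" "j \<in> stores X" "i \<noteq> j"
    and "lo i < r i" "r i \<le> 0" "r j < hi j" "0 \<le> r j"
    and "w i < \<eta> j * w j"
    and "\<forall>k\<in>stores X. lo k < r k \<longrightarrow> w i \<le> w k"
    and "\<forall>k\<in>stores X. r k < hi k \<longrightarrow> \<eta> k * w k \<le> \<eta> j * w j"
    and "0 < a" "a = min (r i - lo i) ((hi j - r j) / \<eta> j)" "r' = transfer X i j a r"
proof -
  obtain i j where sel: "selected_pair X v s r i j" and wo: "worthwhile X v s i j"
    and cc: "cross_charge X s i j r r'"
    using assms(3) by (auto simp: cross_charging_stage_def)
  have can: "can_supply X s r i" "can_accept X s r j"
    using sel by (auto simp: selected_pair_def)
  note signs = worthwhile_pair_signs[OF assms(1,2) can wo]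
  have i: "i \<in> stores X" "lo i < r i" and j: "j \<in> stores X" "r j < hi j"
    using can assms(1) by (auto simp: can_supply_iff can_accept_iff)
  define a where "a = min (r i - lo i) ((hi j - r j) / \<eta> j)"
  have "0 < a"
    using i j efficiency_bounds(1)[OF j(1)] by (simp add: a_def)
  moreover have "r' = transfer X i j a r"
    using cc cross_charge_iff[OF assms(1) i(1) j(1) signs(1)] by (simp add: a_def)
  moreover have "w i < \<eta> j * w j"
    using wo by (simp add: worthwhile_def)
  moreover have "w i \<le> w k" if "k \<in> stores X" "lo k < r k" for k
    using sel that assms(1)
    by (auto simp: selected_pair_def discharging_priority_def can_supply_iff not_less)
  moreover have "\<eta> k * w k \<le> \<eta> j * w j" if "k \<in> stores X" "r k < hi k" for k
    using sel that assms(1)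
    by (auto simp: selected_pair_def charging_priority_def can_accept_iff not_less)
  ultimately show thesis
    using that[of i j a] i j signs a_def by blast
qed

text \<open>
  The values \<open>w i < \<eta> j * w j\<close> of the pair chosen separate all the stores: after the stage, every
  discharging store has \<open>w\<close> at most \<open>w i\<close>, every store that can supply has \<open>w\<close> at least \<open>w i\<close>,
  every charging store has charging value at least \<open>\<eta> j * w j\<close>, and every store that can accept
  has charging value at most \<open>\<eta> j * w j\<close>. The three clauses on priorities follow.
\<close>

lemma cross_charging_stage_invariant:
  assumes "procedure_invariant re r" "cross_charging_stage X v s r r'"
  shows "procedure_invariant re r'" "imbalance X re r' = imbalance X re r"
proof -
  have perm: "permitted r" and prio: "respects_priorities r"
    and bal: "balanced_as_far_as_possible re r"
    using assms(1) by (auto simp: procedure_invariant_def)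
  obtain i j a where ij: "i \<in> stores X" "j \<in> stores X" "i \<noteq> j"
    and i: "lo i < r i" "r i \<le> 0" and j: "r j < hi j" "0 \<le> r j"
    and lt: "w i < \<eta> j * w j"
    and i_best: "\<forall>k\<in>stores X. lo k < r k \<longrightarrow> w i \<le> w k"
    and j_best: "\<forall>k\<in>stores X. r k < hi k \<longrightarrow> \<eta> k * w k \<le> \<eta> j * w j"
    and a: "0 < a" "a = min (r i - lo i) ((hi j - r j) / \<eta> j)" and r': "r' = transfer X i j a r"
    by (rule cross_charging_stageE[OF perm prio assms(2)])
  have eta: "0 < \<eta> j"
    using efficiency_bounds(1)[OF ij(2)] .
  have "a \<le> r i - lo i" "a \<le> (hi j - r j) / \<eta> j"
    unfolding a(2) by simp_all
  then have fits: "a \<le> r i - lo i" "\<eta> j * a \<le> hi j - r j"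
    using eta by (simp_all add: field_simps)
  have gain: "0 < \<eta> j * a"
    using eta a(1) by simp
  have "r' i = r i - a" "r' j = r j + \<eta> j * a"
    using ij(3) by (simp_all add: r' transfer_def)
  then have r'_i: "r' i < 0" "lo i \<le> r' i" "r' i < r i"
    and r'_j: "0 < r' j" "r' j \<le> hi j" "r j < r' j"
    and r'_other: "\<And>k. k \<noteq> i \<Longrightarrow> k \<noteq> j \<Longrightarrow> r' k = r k"
    using i j a(1) fits gain by (simp_all add: r' transfer_def)
  show imb: "imbalance X re r' = imbalance X re r"
    unfolding r' using ij i j a by (intro imbalance_transfer) auto
  have perm': "permitted r'"
    unfolding permitted_def
  proof
    fix k assume "k \<in> stores X"
    then show "lo k \<le> r' k \<and> r' k \<le> hi k"
      using perm r'_i r'_j r'_other[of k] hi_ge_0[OF ij(1)] lo_le_0[OF ij(2)]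
      unfolding permitted_def by (cases "k = i"; cases "k = j") force+
  qed
  \<comment> \<open>Only \<open>j\<close> can have become charging or able to supply, only \<open>i\<close> discharging or able to accept.\<close>
  have charged: "r k > 0 \<or> k = j" if "0 < r' k" for k
    using that r'_i r'_other[of k] by (cases "k = i") auto
  have discharged: "r k < 0 \<or> k = i" if "r' k < 0" for k
    using that r'_j r'_other[of k] by (cases "k = j") auto
  have accepting: "r k < hi k \<or> k = i" if "r' k < hi k" for k
    using that r'_j r'_other[of k] by (cases "k = j") auto
  have supplying: "lo k < r k \<or> k = j" if "lo k < r' k" for k
    using that r'_i r'_other[of k] by (cases "k = i") auto
  have charged_value: "\<eta> j * w j \<le> \<eta> k * w k" if "k \<in> stores X" "0 < r' k" for k
    using charged[OF that(2)] prio that(1) ij j unfolding respects_priorities_def by auto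
  have discharged_value: "w k \<le> w i" if "k \<in> stores X" "r' k < 0" for k
    using discharged[OF that(2)] prio that(1) ij i unfolding respects_priorities_def by auto
  have accepting_value: "\<eta> k * w k \<le> \<eta> j * w j" if "k \<in> stores X" "r' k < hi k" for k
    using accepting[OF that(2)] j_best that(1) lt charging_value_le(2)[OF ij(1)] by auto
  have supplying_value: "w i \<le> w k" if "k \<in> stores X" "lo k < r' k" for k
    using supplying[OF that(2)] i_best that(1) lt charging_value_le(2)[OF ij(2)] by auto
  have "respects_priorities r'"
    unfolding respects_priorities_def
    using charged_value discharged_value accepting_value supplying_value lt
    by (meson less_imp_le order_trans)
  \<comment> \<open>An imbalance would have left either no acceptor \<open>j\<close> or no supplier \<open>i\<close>.\<close>
  moreover have "imbalance X re r = 0"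
    using bal ij i j unfolding balanced_as_far_as_possible_def
      can_supply_iff[OF perm] can_accept_iff[OF perm]
    by (smt (verit))
  then have "balanced_as_far_as_possible re r'"
    by (simp add: balanced_as_far_as_possible_def imb)
  ultimately show "procedure_invariant re r'"
    using perm' by (simp add: procedure_invariant_def)
qed

lemma cross_charging_stages_invariant:
  assumes "(cross_charging_stage X v s)\<^sup>*\<^sup>* r0 r" "procedure_invariant re r0"
  shows "procedure_invariant re r \<and> imbalance X re r = imbalance X re r0"
  using assms by (induction rule: rtranclp_induct) (auto dest: cross_charging_stage_invariant)

section \<open>Cross-charging terminates\<close>

text \<open>
  The stores that can still be cross-charged from or to. The signs matter: lowering a store makes
  it able to accept energy again, but once it is discharging it is never chosen to do so.
  A store at rate \<open>0\<close> may be counted twice, as it may go either way.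
\<close>

definition unsaturated_count :: "('i \<Rightarrow> real) \<Rightarrow> nat" where
  "unsaturated_count r = card {i \<in> stores X. lo i < r i \<and> r i \<le> 0} + card {j \<in> stores X. r j < hi j \<and> 0 \<le> r j}"

lemma cross_charging_stage_decreases:
  assumes "permitted r" "respects_priorities r" "cross_charging_stage X v s r r'"
  shows "unsaturated_count r' < unsaturated_count r"
proof -
  obtain i j a where ij: "i \<in> stores X" "j \<in> stores X" "i \<noteq> j"
    and i: "lo i < r i" "r i \<le> 0" and j: "r j < hi j" "0 \<le> r j"
    and a: "0 < a" "a = min (r i - lo i) ((hi j - r j) / \<eta> j)" and r': "r' = transfer X i j a r"
    by (rule cross_charging_stageE[OF assms])
  let ?D = "\<lambda>r. {i \<in> stores X. lo i < r i \<and> r i \<le> 0}"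
  let ?C = "\<lambda>r. {j \<in> stores X. r j < hi j \<and> 0 \<le> r j}"
  have eta: "0 < \<eta> j"
    using efficiency_bounds(1)[OF ij(2)] .
  have r'_i: "r' i < 0" and r'_j: "0 < r' j"
    and r'_other: "\<And>k. k \<noteq> i \<Longrightarrow> k \<noteq> j \<Longrightarrow> r' k = r k"
    using ij i j a(1) eta by (auto simp: r' transfer_def add_nonneg_pos)
  have D: "?D r' \<subseteq> ?D r"
  proof
    fix k assume "k \<in> ?D r'"
    then show "k \<in> ?D r"
      using i ij r'_j r'_other[of k] by (cases "k = i"; cases "k = j") auto
  qed
  have C: "?C r' \<subseteq> ?C r"
  proof
    fix k assume "k \<in> ?C r'"
    then show "k \<in> ?C r"
      using j ij r'_i r'_other[of k] by (cases "k = i"; cases "k = j") auto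
  qed
  have fin: "finite (?D r)" "finite (?C r)"
    by auto
  consider "a = r i - lo i" | "a = (hi j - r j) / \<eta> j"
    using a(2) by (auto simp: min_def split: if_splits)
  then have "?D r' \<subset> ?D r \<or> ?C r' \<subset> ?C r"
  proof cases
    case 1
    then have "i \<notin> ?D r'"
      using ij(3) by (simp add: r' transfer_def)
    then show ?thesis
      using D i ij(1) by blast
  next
    case 2
    then have "j \<notin> ?C r'"
      using ij(3) eta by (simp add: r' transfer_def)
    then show ?thesis
      using C j ij(2) by blast
  qed
  then show ?thesis
    unfolding unsaturated_count_def
    using psubset_card_mono[OF fin(1)] psubset_card_mono[OF fin(2)]
      card_mono[OF fin(1) D] card_mono[OF fin(2) C]
    by (meson add_le_less_mono add_less_le_mono)
qed

lemma cross_charging_terminates: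
  assumes "procedure_invariant re (f 0)" "\<And>n. cross_charging_stage X v s (f n) (f (Suc n))"
  shows False
proof -
  have reach: "procedure_invariant re (f n)" for n
    by (induction n) (use assms cross_charging_stage_invariant(1) in blast)+
  have "unsaturated_count (f (Suc n)) < unsaturated_count (f n)" for n
    using reach[of n] assms(2) cross_charging_stage_decreases by (simp add: procedure_invariant_def)
  then show False
    using wf_iff_no_infinite_down_chain[THEN iffD1, OF wf_measure[of unsaturated_count]]
    by (auto simp: in_measure)
qed

lemma selected_pair_cross_charge:
  assumes "permitted r" "respects_priorities r" "selected_pair X v s r i j" "worthwhile X v s i j"
  shows "\<exists>r'. cross_charge X s i j r r'"
proof -
  have "can_supply X s r i" "can_accept X s r j"
    using assms(3) by (auto simp: selected_pair_def)
  then show ?thesis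
    using cross_charge_iff[OF assms(1)] worthwhile_pair_signs(1)[OF assms(1,2) _ _ assms(4)]
    by (auto simp: can_supply_def can_accept_def)
qed

lemma cross_charging_finishes:
  assumes "procedure_invariant re r0"
  shows "\<exists>r. (cross_charging_stage X v s)\<^sup>*\<^sup>* r0 r \<and>
    (\<forall>i j. selected_pair X v s r i j \<longrightarrow> \<not> worthwhile X v s i j)"
  using assms
proof (induction "unsaturated_count r0" arbitrary: r0 rule: less_induct)
  case less
  have perm: "permitted r0" "respects_priorities r0"
    using less.prems by (auto simp: procedure_invariant_def)
  show ?case
  proof (cases "\<forall>i j. selected_pair X v s r0 i j \<longrightarrow> \<not> worthwhile X v s i j")
    case False
    then obtain r1 where r1: "cross_charging_stage X v s r0 r1"
      using selected_pair_cross_charge[OF perm] unfolding cross_charging_stage_def by blast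
    then obtain r where "(cross_charging_stage X v s)\<^sup>*\<^sup>* r1 r"
      "\<forall>i j. selected_pair X v s r i j \<longrightarrow> \<not> worthwhile X v s i j"
      using less.hyps[of r1] cross_charging_stage_decreases[OF perm r1]
        cross_charging_stage_invariant(1)[OF less.prems r1] by auto
    then show ?thesis
      using r1 by (meson converse_rtranclp_into_rtranclp)
  qed auto
qed

section \<open>Optimality\<close>

lemma not_worthwhile_selected:
  assumes "selected_pair X v s r i j" "\<not> worthwhile X v s i j"
    and "can_supply X s r i'" "can_accept X s r j'"
  shows "\<not> worthwhile X v s i' j'"
  using assms
  by (force simp: selected_pair_def worthwhile_def discharging_priority_def charging_priority_def)

lemma selected_pair_exists:
  assumes "can_supply X s r i" "can_accept X s r j"
  shows "\<exists>i' j'. selected_pair X v s r i' j'"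
proof -
  have "finite {k. can_supply X s r k}" "finite {k. can_accept X s r k}"
    by (auto simp: can_supply_def can_accept_def)
  then have "\<exists>i'. is_arg_min w (\<lambda>k. k \<in> {k. can_supply X s r k}) i'"
    "\<exists>j'. is_arg_min (\<lambda>k. - (\<eta> k * w k)) (\<lambda>k. k \<in> {k. can_accept X s r k}) j'"
    using assms by (intro ex_is_arg_min_if_finite; auto)+
  then show ?thesis
    by (auto simp: selected_pair_def is_arg_min_def discharging_priority_def charging_priority_def)
qed

text \<open>
  If demand is unserved then no store can move down, and no slope exceeds \<open>1\<close>. Otherwise the
  largest slope of a store that can move up will do, or \<open>0\<close> if there is no such store, as is the
  case when energy is spilled.
\<close>

lemma multiplier_exists:
  assumes "procedure_invariant re r"
    and finished: "\<forall>i j. selected_pair X v s r i j \<longrightarrow> \<not> worthwhile X v s i j"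
  obtains \<mu> where "0 \<le> \<mu>" "\<mu> \<le> 1"
    and "\<And>i. i \<in> stores X \<Longrightarrow> r i < hi i \<Longrightarrow> (if 0 \<le> r i then \<eta> i * w i else w i) \<le> \<mu>"
    and "\<And>i. i \<in> stores X \<Longrightarrow> lo i < r i \<Longrightarrow> \<mu> \<le> (if 0 < r i then \<eta> i * w i else w i)"
    and "re \<ge> 0 \<Longrightarrow> imbalance X re r > 0 \<Longrightarrow> \<mu> = 0"
    and "re < 0 \<Longrightarrow> imbalance X re r < 0 \<Longrightarrow> \<mu> = 1"
proof -
  have perm: "permitted r" and prio: "respects_priorities r"
    and bal: "balanced_as_far_as_possible re r"
    using assms(1) by (auto simp: procedure_invariant_def)
  define up where "up i = (if 0 \<le> r i then \<eta> i * w i else w i)" for i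
  define down where "down i = (if 0 < r i then \<eta> i * w i else w i)" for i
  define M where "M = insert 0 (up ` {i \<in> stores X. r i < hi i})"
  have up: "0 \<le> up i \<and> up i \<le> 1" and down: "0 \<le> down i \<and> down i \<le> 1" if "i \<in> stores X" for i
    using charging_value_le[OF that] value_bounds[OF that] by (auto simp: up_def down_def)
  have up_le_down: "up i \<le> down j"
    if "i \<in> stores X" "r i < hi i" "j \<in> stores X" "lo j < r j" for i j
  proof -
    have can: "can_supply X s r j" "can_accept X s r i"
      using that perm by (auto simp: can_supply_iff can_accept_iff)
    then have "\<not> worthwhile X v s j i"
      using selected_pair_exists[OF can] finished not_worthwhile_selected by metis
    then have "\<eta> i * w i \<le> w j"
      by (simp add: worthwhile_def)
    then show ?thesis
      using prio that unfolding respects_priorities_def up_def down_def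
      by (auto simp: not_le not_less)
  qed
  show thesis
  proof (cases "re < 0 \<and> imbalance X re r < 0")
    case True
    then have "\<not> lo i < r i" if "i \<in> stores X" for i
      using that bal by (simp add: balanced_as_far_as_possible_def can_supply_iff[OF perm])
    then show thesis
      using that[of 1] up True unfolding up_def by auto
  next
    case False
    have fin: "finite M" "M \<noteq> {}"
      by (auto simp: M_def)
    show thesis
    proof (rule that[of "Max M"])
      show "0 \<le> Max M"
        using fin by (intro Max_ge) (auto simp: M_def)
      show "Max M \<le> 1"
        using fin up by (auto simp: M_def)
      show "(if 0 \<le> r i then \<eta> i * w i else w i) \<le> Max M" if "i \<in> stores X" "r i < hi i" for i
        using that fin unfolding up_def[symmetric] by (intro Max_ge) (auto simp: M_def)
      show "Max M \<le> (if 0 < r i then \<eta> i * w i else w i)" if "i \<in> stores X" "lo i < r i" for i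
        using that fin up_le_down down unfolding down_def[symmetric] by (auto simp: M_def)
      show "Max M = 0" if "re \<ge> 0" "imbalance X re r > 0"
      proof -
        have "M = {0}"
          using that bal by (auto simp: M_def balanced_as_far_as_possible_def can_accept_iff[OF perm])
        then show ?thesis
          by simp
      qed
    qed (use False in auto)
  qed
qed

lemma invariant_feasible:
  assumes "procedure_invariant re r"
  shows "feasible X s re r"
  using assms
  by (auto simp: procedure_invariant_def balanced_as_far_as_possible_def feasible_def permitted_def
      rate_permitted_iff can_accept_def can_supply_def)

text \<open>
  Weak duality: by optimality of each store at the price \<open>\<mu>\<close>, changing the rates raises the stored
  value by at most \<open>\<mu>\<close> times the drop in the imbalance. The bounds on \<open>\<mu>\<close> and complementary
  slackness make this no more than the increase in unserved energy.
\<close>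

lemma finished_optimal:
  assumes reach: "procedure_invariant re r"
    and finished: "\<forall>i j. selected_pair X v s r i j \<longrightarrow> \<not> worthwhile X v s i j"
    and feas: "feasible X s re r'"
  shows "linearised_value X v s re r' \<le> linearised_value X v s re r"
proof -
  obtain \<mu> where lam: "0 \<le> \<mu>" "\<mu> \<le> 1"
    and up: "\<And>i. i \<in> stores X \<Longrightarrow> r i < hi i \<Longrightarrow> (if 0 \<le> r i then \<eta> i * w i else w i) \<le> \<mu>"
    and down: "\<And>i. i \<in> stores X \<Longrightarrow> lo i < r i \<Longrightarrow> \<mu> \<le> (if 0 < r i then \<eta> i * w i else w i)"
    and slack: "re \<ge> 0 \<Longrightarrow> imbalance X re r > 0 \<Longrightarrow> \<mu> = 0"
      "re < 0 \<Longrightarrow> imbalance X re r < 0 \<Longrightarrow> \<mu> = 1"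
    using multiplier_exists[OF reach finished] by blast
  let ?u = "imbalance X re r" and ?u' = "imbalance X re r'"
  have feas0: "feasible X s re r"
    using invariant_feasible[OF reach] .
  have "w i * r' i - \<mu> * external i (r' i) \<le> w i * r i - \<mu> * external i (r i)"
    if "i \<in> stores X" for i
    using that feas feas0 up down lam(1)
    by (intro external_optimal) (auto simp: feasible_def rate_permitted_iff)
  then have "(\<Sum>i\<in>stores X. w i * r' i - \<mu> * external i (r' i))
      \<le> (\<Sum>i\<in>stores X. w i * r i - \<mu> * external i (r i))"
    by (rule sum_mono)
  then have lagrange: "(\<Sum>i\<in>stores X. w i * r' i) - (\<Sum>i\<in>stores X. w i * r i) \<le> \<mu> * (?u - ?u')"
    by (simp add: imbalance_eq sum_subtractf sum_distrib_left[symmetric] algebra_simps)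
  have "\<mu> * (?u - ?u') \<le> max 0 (- ?u') - max 0 (- ?u)"
  proof (cases "re \<ge> 0")
    case True
    then have "0 \<le> ?u" "0 \<le> ?u'"
      using feas feas0 by (auto simp: feasible_def)
    then show ?thesis
      using slack(1) True lam(1) by (cases "?u = 0") auto
  next
    case False
    then have u: "?u \<le> 0" "?u' \<le> 0"
      using feas feas0 by (auto simp: feasible_def)
    show ?thesis
    proof (cases "?u = 0")
      case True
      then show ?thesis
        using u mult_right_mono[OF lam(2), of "- ?u'"] by auto
    next
      case neq: False
      then show ?thesis
        using u slack(2) False by auto
    qed
  qed
  then show ?thesis
    using lagrange by (simp add: linearised_value_def)
qed

lemma initial_rates_exist: "\<exists>r0. initial_rates X v s re r0"
proof -
  obtain zs where zs: "set zs = stores X" "distinct zs"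
    using finite_distinct_list[OF finite_stores] by blast
  have "charging_order X v s (sort_key (\<lambda>i. - (\<eta> i * w i)) zs)"
    using sorted_sort_key[of "\<lambda>i. - (\<eta> i * w i)" zs] zs
    by (simp add: charging_order_def charging_priority_def sorted_map not_less)
  moreover have "discharging_order X v s (sort_key w zs)"
    using sorted_sort_key[of w zs] zs
    by (simp add: discharging_order_def discharging_priority_def sorted_map not_less)
  ultimately show ?thesis
    by (auto simp: initial_rates_def)
qed

lemma no_stage_if_spilled_or_unserved:
  assumes "procedure_invariant re r" "re \<ge> 0 \<and> imbalance X re r > 0 \<or> re < 0 \<and> imbalance X re r < 0"
  shows "\<not> cross_charging_stage X v s r r'"
  using assms
  by (auto simp: procedure_invariant_def balanced_as_far_as_possible_def cross_charging_stage_def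
      selected_pair_def)

end

section \<open>Optimality of the procedure\<close>

theorem proposition2:
  fixes X :: "'i storage"
    and t :: int
    and s :: "'i \<Rightarrow> real"
    and re :: "int \<Rightarrow> real"
    and V :: "int \<Rightarrow> ('i \<Rightarrow> real) \<Rightarrow> real"
    and v :: "int \<Rightarrow> 'i \<Rightarrow> ('i \<Rightarrow> real) \<Rightarrow> real"
  assumes "valid_storage X"
    and "s \<in> levels X"
    and "marginal_values X (V t) (v t)"
  shows "(\<exists>r. procedure_result X (v t) s (re t) r)
    \<and> (\<forall>r. procedure_result X (v t) s (re t) r \<longrightarrow>
          is_arg_max (linearised_value X (v t) s (re t)) (feasible X s (re t)) r)
    \<and> (\<forall>r0. initial_rates X (v t) s (re t) r0 \<longrightarrow>
          \<not> (\<exists>f :: nat \<Rightarrow> 'i \<Rightarrow> real. f 0 = r0 \<and>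
               (\<forall>n. cross_charging_stage X (v t) s (f n) (f (Suc n)))) \<and>
          (\<forall>r. (cross_charging_stage X (v t) s)\<^sup>*\<^sup>* r0 r \<longrightarrow>
             feasible X s (re t) r \<and>
             imbalance X (re t) r = imbalance X (re t) r0 \<and>
             (\<forall>i j. selected_pair X (v t) s r i j \<and> worthwhile X (v t) s i j \<longrightarrow>
                (\<exists>r'. cross_charge X s i j r r')) \<and>
             (\<forall>i j. selected_pair X (v t) s r i j \<and> \<not> worthwhile X (v t) s i j \<longrightarrow>
                (\<forall>i' j'. can_supply X s r i' \<and> can_accept X s r j' \<longrightarrow>
                   \<not> worthwhile X (v t) s i' j')) \<and>
             (re t \<ge> 0 \<and> imbalance X (re t) r > 0 \<or> re t < 0 \<and> imbalance X (re t) r < 0 \<longrightarrow>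
                \<not> (\<exists>r'. cross_charging_stage X (v t) s r r'))))"
proof -
  interpret storage_step X "v t" s
    using assms by unfold_locales (auto simp: marginal_values_def)
  show ?thesis
  proof (intro conjI allI impI)
    obtain r0 where r0: "initial_rates X (v t) s (re t) r0"
      using initial_rates_exist by blast
    then show "\<exists>r. procedure_result X (v t) s (re t) r"
      using cross_charging_finishes[OF initial_rates_invariant]
      unfolding procedure_result_def by blast
  next
    fix r assume r: "procedure_result X (v t) s (re t) r"
    then have reach: "procedure_invariant (re t) r"
      and finished: "\<forall>i j. selected_pair X (v t) s r i j \<longrightarrow> \<not> worthwhile X (v t) s i j"
      unfolding procedure_result_def
      using cross_charging_stages_invariant initial_rates_invariant by blast+
    show "is_arg_max (linearised_value X (v t) s (re t)) (feasible X s (re t)) r"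
      using finished_optimal[OF reach finished] invariant_feasible[OF reach]
      by (auto simp: is_arg_max_def not_less)
  next
    fix r0 assume r0: "initial_rates X (v t) s (re t) r0"
    note reach0 = initial_rates_invariant[OF r0]
    show "\<not> (\<exists>f :: nat \<Rightarrow> 'i \<Rightarrow> real. f 0 = r0 \<and>
        (\<forall>n. cross_charging_stage X (v t) s (f n) (f (Suc n))))"
      using cross_charging_terminates reach0 by metis
    fix r assume "(cross_charging_stage X (v t) s)\<^sup>*\<^sup>* r0 r"
    from cross_charging_stages_invariant[OF this reach0]
    have reach: "procedure_invariant (re t) r"
      and imb: "imbalance X (re t) r = imbalance X (re t) r0"
      by blast+
    show "feasible X s (re t) r"
      using invariant_feasible[OF reach] .
    show "imbalance X (re t) r = imbalance X (re t) r0"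
      by (rule imb)
    show "\<exists>r'. cross_charge X s i j r r'"
      if "selected_pair X (v t) s r i j \<and> worthwhile X (v t) s i j" for i j
      using selected_pair_cross_charge that reach unfolding procedure_invariant_def by blast
    show "\<not> worthwhile X (v t) s i' j'"
      if "selected_pair X (v t) s r i j \<and> \<not> worthwhile X (v t) s i j"
        "can_supply X s r i' \<and> can_accept X s r j'" for i j i' j'
      using not_worthwhile_selected that by blast
    show "\<not> (\<exists>r'. cross_charging_stage X (v t) s r r')"
      if "re t \<ge> 0 \<and> imbalance X (re t) r > 0 \<or> re t < 0 \<and> imbalance X (re t) r < 0"
      using no_stage_if_spilled_or_unserved[OF reach that] by blast
  qed
qed

end
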